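(* Let $\{\Upsilon_j\mid j\in\mathbb{N}\}$ be a sequence of nonnegative real numbers. Then $$\sum_{v\subseteq \mathbb{N}} |v|!\, m^{|v|}\prod_{j\in v} \Upsilon_j<\infty \text{ for all real } m>0$$ if and only if $\sum_{j=1}^\infty \Upsilon_j<\infty$.
   Context: $\mathbb{N}=\{1,2,3,\dots\}$. Sums over $v\subseteq\mathbb{N}$ run over all finite subsets of $\mathbb{N}$, including the empty set; empty products equal $1$. *)

theory Defs
  imports "HOL-Analysis.Analysis"
begin

end

theory Submission
  imports Defs
begin

text \<open>
  The converse direction only uses the singletons. For the other one, let
  \<open>G(A)\<close> be the sum of \<open>|v|! \<Prod>\<^bsub>j\<in>v\<^esub> x\<^sub>j\<close> over \<open>v \<subseteq> A\<close>. Writing \<open>|v|!\<close> as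
  \<open>|v| (|v| - 1)!\<close> and distributing the factor \<open>|v|\<close> over the elements of \<open>v\<close> yields
  \<open>G(A) = 1 + \<Sum>\<^bsub>j\<in>A\<^esub> x\<^sub>j G(A - {j})\<close>, so \<open>G(A) \<le> 1 / (1 - s)\<close> whenever
  \<open>\<Sum>\<^bsub>j\<in>A\<^esub> x\<^sub>j \<le> s < 1\<close>. Scaling by \<open>m\<close> is harmless: since
  \<open>(k + l)! \<le> 2\<^sup>k\<^sup>+\<^sup>l k! l!\<close>, a finite head can be split off, at the price of a factor \<open>2\<close> on
  the \<open>x\<^sub>j\<close>, so that what remains is a tail of sum at most \<open>1/2\<close>.
\<close>

definition fact_subset_sum :: "('a \<Rightarrow> real) \<Rightarrow> 'a set \<Rightarrow> real" where
  "fact_subset_sum x A = (\<Sum>v\<in>Pow A. fact (card v) * (\<Prod>j\<in>v. x j))"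

lemma fact_subset_sum_rec:
  assumes "finite A"
  shows "fact_subset_sum x A = 1 + (\<Sum>j\<in>A. x j * fact_subset_sum x (A - {j}))"
proof -
  let ?g = "\<lambda>v. fact (card v) * (\<Prod>j\<in>v. x j)"
  let ?h = "\<lambda>v. fact (card v - 1) * (\<Prod>j\<in>v. x j)"
  \<comment> \<open>Each of the \<open>card v\<close> elements of \<open>v\<close> receives one copy
    of \<open>?h v\<close>. The empty set must stay out: it would receive nothing, while
    \<open>?g {}\<close> is 1, the leading 1 of the recursion.\<close>
  have expand: "?g v = (\<Sum>j\<in>A. if j \<in> v then ?h v else 0)" if "v \<in> Pow A - {{}}" for v
  proof -
    have v: "v \<subseteq> A" "finite v" "card v \<noteq> 0"
      using that assms finite_subset by fastforce+
    have "(\<Sum>j\<in>A. if j \<in> v then ?h v else 0) = (\<Sum>j\<in>v. ?h v)"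
      using v assms by (simp add: sum.If_cases inf_absorb2)
    also have "\<dots> = ?g v"
      using v by (simp add: fact_reduce card_gt_0_iff)
    finally show ?thesis by simp
  qed
  have inner: "(\<Sum>v\<in>Pow A - {{}}. if j \<in> v then ?h v else 0)
      = x j * fact_subset_sum x (A - {j})" if "j \<in> A" for j
  proof -
    have "(\<Sum>v\<in>Pow A - {{}}. if j \<in> v then ?h v else 0) = (\<Sum>v | v \<subseteq> A \<and> j \<in> v. ?h v)"
      using assms by (intro sum.mono_neutral_cong_right) auto
    \<comment> \<open>Removing \<open>j\<close> matches the sets \<open>v\<close> containing
      \<open>j\<close> with the subsets of \<open>A - {j}\<close>; the shifted factorial in
      \<open>?h v\<close> is exactly that of the smaller set.\<close>
    also have "\<dots> = (\<Sum>w\<in>Pow (A - {j}). x j * ?g w)"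
    proof (rule sum.reindex_bij_witness[where i = "insert j" and j = "\<lambda>v. v - {j}"])
      fix v assume "v \<in> {v. v \<subseteq> A \<and> j \<in> v}"
      then have "finite v" "j \<in> v"
        using assms finite_subset by auto
      then show "x j * ?g (v - {j}) = ?h v"
        by (simp add: prod.remove[of v j])
    qed (use that in auto)
    finally show ?thesis
      by (simp add: fact_subset_sum_def sum_distrib_left)
  qed
  have "fact_subset_sum x A = 1 + (\<Sum>v\<in>Pow A - {{}}. ?g v)"
    using assms by (simp add: fact_subset_sum_def sum.remove[of "Pow A" "{}"])
  also have "(\<Sum>v\<in>Pow A - {{}}. ?g v)
      = (\<Sum>v\<in>Pow A - {{}}. \<Sum>j\<in>A. if j \<in> v then ?h v else 0)"
    by (rule sum.cong[OF refl expand])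
  also have "\<dots> = (\<Sum>j\<in>A. \<Sum>v\<in>Pow A - {{}}. if j \<in> v then ?h v else 0)"
    by (rule sum.swap)
  also have "\<dots> = (\<Sum>j\<in>A. x j * fact_subset_sum x (A - {j}))"
    by (rule sum.cong[OF refl inner])
  finally show ?thesis .
qed

text \<open>The bound is the fixed point of c = 1 + s * c, so the recursion reproduces it. Keeping
  \<open>s\<close> fixed lets the induction pass to \<open>A - {j}\<close>, whose sum is no
  larger.\<close>

lemma fact_subset_sum_le:
  assumes "finite A" and "\<And>j. j \<in> A \<Longrightarrow> x j \<ge> 0" and "sum x A \<le> s" and "s < 1"
  shows "fact_subset_sum x A \<le> 1 / (1 - s)"
  using assms(1-3)
proof (induction A rule: finite_psubset_induct)
  case (psubset A)
  have IH: "fact_subset_sum x (A - {j}) \<le> 1 / (1 - s)" if "j \<in> A" for j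
  proof (rule psubset.IH)
    have "sum x (A - {j}) \<le> sum x A"
      using psubset.hyps psubset.prems(1) by (intro sum_mono2) auto
    then show "sum x (A - {j}) \<le> s"
      using psubset.prems(2) by linarith
  qed (use that psubset.prems(1) in auto)
  have "fact_subset_sum x A = 1 + (\<Sum>j\<in>A. x j * fact_subset_sum x (A - {j}))"
    using psubset.hyps by (rule fact_subset_sum_rec)
  also have "\<dots> \<le> 1 + (\<Sum>j\<in>A. x j * (1 / (1 - s)))"
    using IH psubset.prems(1) by (intro add_left_mono sum_mono mult_left_mono) auto
  also have "\<dots> = 1 + sum x A * (1 / (1 - s))"
    by (simp only: sum_distrib_right)
  also have "\<dots> \<le> 1 + s * (1 / (1 - s))"
    using psubset.prems(2) assms(4) by (intro add_left_mono mult_right_mono) auto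
  also have "\<dots> = 1 / (1 - s)"
    using assms(4) by (simp add: field_simps)
  finally show ?case .
qed

text \<open>The quotient of the factorials is a binomial coefficient, one of the terms in the
  expansion of \<open>(1 + 1) ^ (k + l)\<close>.\<close>

lemma fact_add_le: "(fact (k + l) :: real) \<le> 2 ^ (k + l) * (fact k * fact l)"
proof -
  have "(fact (k + l) :: real) = fact k * fact l * real ((k + l) choose k)"
    by (simp add: binomial_fact)
  also have "\<dots> \<le> fact k * fact l * 2 ^ (k + l)"
    using of_nat_mono[OF binomial_le_pow2[of "k + l" k], where 'a = real]
    by (intro mult_left_mono) simp_all
  finally show ?thesis by (simp add: mult.commute)
qed

text \<open>Subsets of the disjoint union correspond to pairs \<open>(u, w)\<close>. The loss
  \<open>2 ^ (card u + card w)\<close> from splitting the factorial is one factor 2 per element,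
  hence the doubled weights.\<close>

lemma fact_subset_sum_Un_le:
  assumes "finite F" "finite A" "F \<inter> A = {}" and nonneg: "\<And>j. j \<in> F \<union> A \<Longrightarrow> x j \<ge> 0"
  shows "fact_subset_sum x (F \<union> A)
    \<le> fact_subset_sum (\<lambda>j. 2 * x j) F * fact_subset_sum (\<lambda>j. 2 * x j) A"
proof -
  let ?g = "\<lambda>v. fact (card v) * (\<Prod>j\<in>v. x j)"
  let ?g2 = "\<lambda>v. fact (card v) * (\<Prod>j\<in>v. 2 * x j)"
  have "fact_subset_sum x (F \<union> A) = (\<Sum>(u, w)\<in>Pow F \<times> Pow A. ?g (u \<union> w))"
    unfolding fact_subset_sum_def
    by (rule sum.reindex_bij_witness[where i = "\<lambda>(u, w). u \<union> w" and j = "\<lambda>v. (v \<inter> F, v \<inter> A)"])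
      (use assms(3) in \<open>auto simp: Int_Un_distrib2 Int_absorb2 simp flip: Int_Un_distrib\<close>)
  also have "\<dots> \<le> (\<Sum>(u, w)\<in>Pow F \<times> Pow A. ?g2 u * ?g2 w)"
  proof (rule sum_mono, clarify)
    fix u w assume u: "u \<subseteq> F" and w: "w \<subseteq> A"
    then have fin: "finite u" "finite w" "u \<inter> w = {}"
      using assms(1-3) finite_subset by blast+
    have "?g (u \<union> w) = fact (card u + card w) * ((\<Prod>j\<in>u. x j) * (\<Prod>j\<in>w. x j))"
      using fin by (simp add: card_Un_disjoint prod.union_disjoint)
    also have "\<dots> \<le> 2 ^ (card u + card w) * (fact (card u) * fact (card w))
        * ((\<Prod>j\<in>u. x j) * (\<Prod>j\<in>w. x j))"
      using u w nonneg by (intro mult_right_mono fact_add_le mult_nonneg_nonneg prod_nonneg) blast+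
    also have "\<dots> = ?g2 u * ?g2 w"
      by (simp add: prod.distrib power_add)
    finally show "?g (u \<union> w) \<le> ?g2 u * ?g2 w" .
  qed
  also have "\<dots> = fact_subset_sum (\<lambda>j. 2 * x j) F * fact_subset_sum (\<lambda>j. 2 * x j) A"
    by (simp add: fact_subset_sum_def sum_product sum.cartesian_product)
  finally show ?thesis .
qed

lemma fact_subset_sum_nonneg:
  assumes "\<And>j. j \<in> A \<Longrightarrow> x j \<ge> 0"
  shows "fact_subset_sum x A \<ge> 0"
  unfolding fact_subset_sum_def
  using assms by (intro sum_nonneg mult_nonneg_nonneg prod_nonneg) auto

lemma fact_subset_sum_bounded:
  fixes x :: "nat \<Rightarrow> real"
  assumes "summable x" and nonneg: "\<And>j. x j \<ge> 0"
  obtains C where "\<And>B. finite B \<Longrightarrow> fact_subset_sum x B \<le> C"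
proof -
  \<comment> \<open>Doubling turns 1/4 into 1/2, and s = 1/2 gives the bound 2 in
    \<open>tail\<close>.\<close>
  obtain N where N: "norm (sum x {p..<q}) < 1 / 4" if "p \<ge> N" for p q
    using assms(1) unfolding summable_Cauchy by (meson zero_less_divide_1_iff zero_less_numeral)
  have tail: "fact_subset_sum (\<lambda>j. 2 * x j) A \<le> 2" if "finite A" "A \<subseteq> {N..}" for A
  proof -
    obtain q where "A \<subseteq> {..<q}"
      using \<open>finite A\<close> finite_nat_bounded by blast
    then have "sum x A \<le> sum x {N..<q}"
      using that nonneg by (intro sum_mono2) fastforce+
    also have "\<dots> \<le> 1 / 4"
      using N[of N q] by simp
    finally have "(\<Sum>j\<in>A. 2 * x j) \<le> 1 / 2"
      by (simp flip: sum_distrib_left)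
    then show ?thesis
      using fact_subset_sum_le[of A "\<lambda>j. 2 * x j" "1 / 2"] that(1) nonneg by simp
  qed
  have "fact_subset_sum x B \<le> fact_subset_sum (\<lambda>j. 2 * x j) {..<N} * 2" if "finite B" for B
  proof -
    \<comment> \<open>Enlarging \<open>B\<close> to contain the whole head makes the head factor
      independent of \<open>B\<close>.\<close>
    have "fact_subset_sum x B \<le> fact_subset_sum x ({..<N} \<union> (B - {..<N}))"
      unfolding fact_subset_sum_def using that nonneg
      by (intro sum_mono2 mult_nonneg_nonneg prod_nonneg) auto
    also have "\<dots> \<le> fact_subset_sum (\<lambda>j. 2 * x j) {..<N}
        * fact_subset_sum (\<lambda>j. 2 * x j) (B - {..<N})"
      using that nonneg by (intro fact_subset_sum_Un_le) auto
    also have "\<dots> \<le> fact_subset_sum (\<lambda>j. 2 * x j) {..<N} * 2"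
      using that nonneg by (intro mult_left_mono tail fact_subset_sum_nonneg) auto
    finally show ?thesis .
  qed
  then show ?thesis by (rule that)
qed

theorem theorem2:
  fixes \<Upsilon> :: "nat \<Rightarrow> real"
  assumes "\<And>j. j \<ge> 1 \<Longrightarrow> \<Upsilon> j \<ge> 0"
  shows "(\<forall>m::real. m > 0 \<longrightarrow>
            (\<lambda>v. fact (card v) * m ^ card v * (\<Prod>j\<in>v. \<Upsilon> j))
              summable_on {v. finite v \<and> v \<subseteq> {1..}})
         \<longleftrightarrow> summable (\<lambda>j. \<Upsilon> (Suc j))"
    (is "?L \<longleftrightarrow> ?R")
proof
  assume ?L
  then have "(\<lambda>v. fact (card v) * 1 ^ card v * (\<Prod>j\<in>v. \<Upsilon> j))
      summable_on {v. finite v \<and> v \<subseteq> {1..}}"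
    using zero_less_one by blast
  \<comment> \<open>With m = 1, the term at the singleton \<open>{Suc j}\<close> is just
    \<open>\<Upsilon> (Suc j)\<close>.\<close>
  then have "(\<lambda>v. fact (card v) * 1 ^ card v * (\<Prod>j\<in>v. \<Upsilon> j)) summable_on range (\<lambda>j. {Suc j})"
    by (rule summable_on_subset_banach) auto
  then have "(\<lambda>j. \<Upsilon> (Suc j)) summable_on UNIV"
    by (subst (asm) summable_on_reindex) (auto simp: inj_on_def o_def)
  then show ?R
    by (rule summable_on_imp_summable)
next
  assume ?R
  show ?L
  proof (intro allI impI)
    fix m :: real assume "m > 0"
    \<comment> \<open>The power of \<open>m\<close> is absorbed into the weights. The sign of
      \<open>\<Upsilon> 0\<close> is unknown, so index 0 gets weight 0 to make \<open>x\<close>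
      nonnegative everywhere.\<close>
    define x where "x j = (if j = 0 then 0 else m * \<Upsilon> j)" for j
    have nonneg: "x j \<ge> 0" for j
      using assms[of j] \<open>m > 0\<close> by (simp add: x_def)
    have "summable (\<lambda>j. x (Suc j))"
      using \<open>?R\<close> by (simp add: x_def summable_mult)
    then have "summable x"
      by (simp only: summable_Suc_iff)
    then obtain C where C: "\<And>B. finite B \<Longrightarrow> fact_subset_sum x B \<le> C"
      using fact_subset_sum_bounded nonneg by metis
    have summable_x: "(\<lambda>v. fact (card v) * (\<Prod>j\<in>v. x j))
        summable_on {v. finite v \<and> v \<subseteq> {1..}}"
    proof (rule nonneg_bounded_partial_sums_imp_summable_on)
      show "\<forall>\<^sub>F W in finite_subsets_at_top {v. finite v \<and> v \<subseteq> {1..}}.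
          (\<Sum>v\<in>W. fact (card v) * (\<Prod>j\<in>v. x j)) \<le> C"
      proof (intro eventually_finite_subsets_at_top_weakI)
        fix W assume W: "finite W" "W \<subseteq> {v. finite v \<and> v \<subseteq> {1::nat..}}"
        then have "finite (\<Union>W)" by auto
        \<comment> \<open>\<open>W\<close> is a family of subsets of its finite union, so passing to
          all subsets of that union only adds nonnegative terms.\<close>
        have "(\<Sum>v\<in>W. fact (card v) * (\<Prod>j\<in>v. x j)) \<le> fact_subset_sum x (\<Union>W)"
          unfolding fact_subset_sum_def using \<open>finite (\<Union>W)\<close> nonneg
          by (intro sum_mono2 mult_nonneg_nonneg prod_nonneg) auto
        also have "\<dots> \<le> C"
          by (rule C) fact
        finally show "(\<Sum>v\<in>W. fact (card v) * (\<Prod>j\<in>v. x j)) \<le> C" .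
      qed
    qed (use nonneg in \<open>auto intro!: mult_nonneg_nonneg prod_nonneg\<close>)
    have eq: "fact (card v) * (\<Prod>j\<in>v. x j) = fact (card v) * m ^ card v * (\<Prod>j\<in>v. \<Upsilon> j)"
      if "v \<in> {v. finite v \<and> v \<subseteq> {1..}}" for v
    proof -
      \<comment> \<open>Since 0 is not in \<open>v\<close>, the default value of \<open>x\<close> is
        never met.\<close>
      have "(\<Prod>j\<in>v. x j) = (\<Prod>j\<in>v. m * \<Upsilon> j)"
        using that by (intro prod.cong) (auto simp: x_def)
      then show ?thesis
        by (simp add: prod.distrib)
    qed
    show "(\<lambda>v. fact (card v) * m ^ card v * (\<Prod>j\<in>v. \<Upsilon> j))
        summable_on {v. finite v \<and> v \<subseteq> {1..}}"
      by (rule iffD1[OF summable_on_cong[OF eq] summable_x])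
  qed
qed

end
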